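(* Assume that the Markov chains $\{\tilde{\boldsymbol Y}_n\}$, $\{\tilde{\boldsymbol Y}^{(1)}_n\}$ and $\{\tilde{\boldsymbol Y}^{(2)}_n\}$ are irreducible and aperiodic. Let $z,w\in\mathbb{C}$ with $z\ne0$ and $w\ne0$. If $|z|\ne z$ or $|w|\ne w$, then $\mathrm{spr}(C(z,w))<\mathrm{spr}(C(|z|,|w|))$.
   Context: Let $\mathbb{H}=\{-1,0,1\}$, $\mathbb{H}_+=\{0,1\}$, and let $S_0=\{1,\dots,s_0\}$ be finite. Let $A_{i,j}$ ($i,j\in\mathbb{H}$), $A^{(1)}_{i,j}$ ($i\in\mathbb{H},j\in\mathbb{H}_+$), $A^{(2)}_{i,j}$ ($i\in\mathbb{H}_+,j\in\mathbb{H}$) be nonnegative $s_0\times s_0$ matrices such that $\sum A_{i,j}$, $\sum A^{(1)}_{i,j}$, $\sum A^{(2)}_{i,j}$ are stochastic. $\{\tilde{\boldsymbol Y}_n\}$ is the Markov chain on $\mathbb{Z}^2\times S_0$ whose transition block from $(x_1,x_2)$ to $(x_1+i,x_2+j)$ is $A_{i,j}$ ($i,j\in\mathbb H$); $\{\tilde{\boldsymbol Y}^{(1)}_n\}$ is the chain on $\mathbb{Z}\times\mathbb{Z}_+\times S_0$ whose block is $A_{i,j}$ if $x_2\ne0$ and $A^{(1)}_{i,j}$ if $x_2=0$; $\{\tilde{\boldsymbol Y}^{(2)}_n\}$ is the chain on $\mathbb{Z}_+\times\mathbb{Z}\times S_0$ whose block is $A_{i,j}$ if $x_1\neq0$ and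 $A^{(2)}_{i,j}$ if $x_1=0$; all other blocks are zero. For nonzero complex $z,w$, $C(z,w)=\sum_{i,j\in\mathbb{H}}A_{i,j}z^iw^j$. $\mathrm{spr}$ denotes the spectral radius (maximum modulus of the eigenvalues). *)

theory Defs
  imports
    "HOL-Analysis.Infinite_Sum"
    "Jordan_Normal_Form.Spectral_Radius"
begin

text \<open>The finite phase set with \<open>s\<^sub>0\<close> elements is indexed by \<open>{0..<s\<^sub>0}\<close>, the indices of matrices in
  \<open>carrier_mat s\<^sub>0 s\<^sub>0\<close>. A state is a triple of two integer levels and a phase.\<close>

type_synonym state = "int \<times> int \<times> nat"

definition H :: "int set" where
  "H = {-1, 0, 1}"

definition Hp :: "int set" where
  "Hp = {0, 1}"

definition block_sum :: "nat \<Rightarrow> int set \<Rightarrow> int set \<Rightarrow> (int \<Rightarrow> int \<Rightarrow> real mat) \<Rightarrow> real mat" where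
  "block_sum s0 I J B = mat s0 s0 (\<lambda>(k, l). \<Sum>i\<in>I. \<Sum>j\<in>J. B i j $$ (k, l))"

definition nonneg_matrix :: "real mat \<Rightarrow> bool" where
  "nonneg_matrix M \<longleftrightarrow> (\<forall>a\<in>elements_mat M. 0 \<le> a)"

definition stochastic_matrix :: "nat \<Rightarrow> real mat \<Rightarrow> bool" where
  "stochastic_matrix s0 M \<longleftrightarrow>
     M \<in> carrier_mat s0 s0 \<and> nonneg_matrix M \<and> (\<forall>k<s0. (\<Sum>l<s0. M $$ (k, l)) = 1)"

definition transition_blocks :: "nat \<Rightarrow> int set \<Rightarrow> int set \<Rightarrow> (int \<Rightarrow> int \<Rightarrow> real mat) \<Rightarrow> bool" where
  "transition_blocks s0 I J B \<longleftrightarrow>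
     (\<forall>i\<in>I. \<forall>j\<in>J. B i j \<in> carrier_mat s0 s0 \<and> nonneg_matrix (B i j)) \<and>
     stochastic_matrix s0 (block_sum s0 I J B)"

text \<open>One-step probability of moving from \<open>x\<close> to \<open>y\<close> when the increments \<open>(i, j)\<close> of the levels
  range over \<open>I \<times> J\<close> and are governed by the blocks \<open>B i j\<close>.\<close>

fun jump :: "int set \<Rightarrow> int set \<Rightarrow> (int \<Rightarrow> int \<Rightarrow> real mat) \<Rightarrow> state \<Rightarrow> state \<Rightarrow> real" where
  "jump I J B (x1, x2, k) (y1, y2, l) =
     (if y1 - x1 \<in> I \<and> y2 - x2 \<in> J then B (y1 - x1) (y2 - x2) $$ (k, l) else 0)"

definition S_free :: "nat \<Rightarrow> state set" where
  "S_free s0 = {(x1, x2, k). k < s0}"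

definition P_free :: "(int \<Rightarrow> int \<Rightarrow> real mat) \<Rightarrow> state \<Rightarrow> state \<Rightarrow> real" where
  "P_free A = jump H H A"

definition S_one :: "nat \<Rightarrow> state set" where
  "S_one s0 = {(x1, x2, k). 0 \<le> x2 \<and> k < s0}"

definition P_one ::
  "(int \<Rightarrow> int \<Rightarrow> real mat) \<Rightarrow> (int \<Rightarrow> int \<Rightarrow> real mat) \<Rightarrow> state \<Rightarrow> state \<Rightarrow> real" where
  "P_one A A1 = (\<lambda>(x1, x2, k). if x2 \<noteq> 0 then jump H H A (x1, x2, k) else jump H Hp A1 (x1, x2, k))"

definition S_two :: "nat \<Rightarrow> state set" where
  "S_two s0 = {(x1, x2, k). 0 \<le> x1 \<and> k < s0}"

definition P_two ::
  "(int \<Rightarrow> int \<Rightarrow> real mat) \<Rightarrow> (int \<Rightarrow> int \<Rightarrow> real mat) \<Rightarrow> state \<Rightarrow> state \<Rightarrow> real" where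
  "P_two A A2 = (\<lambda>(x1, x2, k). if x1 \<noteq> 0 then jump H H A (x1, x2, k) else jump Hp H A2 (x1, x2, k))"

text \<open>For transition probabilities \<open>P\<close> on a countable state space \<open>S\<close>, \<open>nstep S P n x y\<close> is the
  \<open>n\<close>-step transition probability, i.e. the \<open>(x, y)\<close> entry of the \<open>n\<close>-th power of \<open>P\<close>.\<close>

fun nstep :: "'s set \<Rightarrow> ('s \<Rightarrow> 's \<Rightarrow> real) \<Rightarrow> nat \<Rightarrow> 's \<Rightarrow> 's \<Rightarrow> real" where
  "nstep S P 0 x y = (if x = y then 1 else 0)"
| "nstep S P (Suc n) x y = (\<Sum>\<^sub>\<infinity>u\<in>S. P x u * nstep S P n u y)"

definition irreducible_chain :: "'s set \<Rightarrow> ('s \<Rightarrow> 's \<Rightarrow> real) \<Rightarrow> bool" where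
  "irreducible_chain S P \<longleftrightarrow> (\<forall>x\<in>S. \<forall>y\<in>S. \<exists>n. 0 < nstep S P n x y)"

definition aperiodic_chain :: "'s set \<Rightarrow> ('s \<Rightarrow> 's \<Rightarrow> real) \<Rightarrow> bool" where
  "aperiodic_chain S P \<longleftrightarrow> (\<forall>x\<in>S. Gcd {n. 1 \<le> n \<and> 0 < nstep S P n x x} = (1::nat))"

definition C_mat :: "nat \<Rightarrow> (int \<Rightarrow> int \<Rightarrow> real mat) \<Rightarrow> complex \<Rightarrow> complex \<Rightarrow> complex mat" where
  "C_mat s0 A z w = mat s0 s0 (\<lambda>(k, l).
     \<Sum>i\<in>H. \<Sum>j\<in>H. complex_of_real (A i j $$ (k, l)) * z powi i * w powi j)"

end

theory Submission
  imports Defs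
begin

text \<open>Irreducibility and aperiodicity of the free chain give an \<open>N\<close> such that all displacements
  \<open>(0, 0)\<close>, \<open>(1, 0)\<close>, \<open>(0, 1)\<close> are possible in \<open>N\<close> steps between any two phases. The
  corresponding terms \<open>1\<close>, \<open>z\<close>, \<open>w\<close> in an entry of \<open>C(z,w)\<^sup>N\<close> do not all point in the same
  direction, so every entry is strictly smaller in modulus than that of \<open>C(|z|,|w|)\<^sup>N\<close>, and this
  forces the strict inequality of the spectral radii.\<close>

subsection \<open>Strict domination of a matrix power\<close>

lemma index_pow_mat_add:
  fixes A :: "'a :: semiring_1 mat"
  assumes A: "A \<in> carrier_mat n n" and "k < n" "l < n"
  shows "(A ^\<^sub>m (a + b)) $$ (k, l) = (\<Sum>j<n. (A ^\<^sub>m a) $$ (k, j) * (A ^\<^sub>m b) $$ (j, l))"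
proof -
  have "A ^\<^sub>m (a + b) = A ^\<^sub>m a * A ^\<^sub>m b"
  proof (induction b)
    case 0
    show ?case using A by simp
  next
    case (Suc b)
    then show ?case using A by (simp add: assoc_mult_mat[of _ n n _ n _ n])
  qed
  then show ?thesis
    using assms by (simp add: scalar_prod_def lessThan_atLeast0)
qed

lemma pow_smult_mat:
  fixes A :: "'a :: comm_semiring_1 mat"
  assumes A: "A \<in> carrier_mat n n"
  shows "(a \<cdot>\<^sub>m A) ^\<^sub>m k = a ^ k \<cdot>\<^sub>m A ^\<^sub>m k"
proof (induction k)
  case 0
  show ?case using A by (auto intro!: eq_matI)
next
  case (Suc k)
  have "(a \<cdot>\<^sub>m A) ^\<^sub>m Suc k = a ^ k \<cdot>\<^sub>m A ^\<^sub>m k * (a \<cdot>\<^sub>m A)"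
    by (simp add: Suc)
  also have "\<dots> = a ^ Suc k \<cdot>\<^sub>m (A ^\<^sub>m k * A)"
    using A by (intro eq_matI)
      (auto simp: scalar_prod_def sum_distrib_left mult_ac intro!: sum.cong)
  finally show ?case by simp
qed

text \<open>Dividing \<open>A\<close> by \<open>s\<close> pushes the spectral radius below 1, where
  the Jordan normal form bounds the entries of all powers by one constant. Scaling back yields the
  factor \<open>s ^ m\<close>.\<close>

lemma spectral_radius_less_imp_pow_bound:
  assumes A: "A \<in> carrier_mat n n" and n: "n > 0" and s: "spectral_radius A < s" "0 < s"
  obtains c where "\<And>m k l. k < n \<Longrightarrow> l < n \<Longrightarrow> cmod ((A ^\<^sub>m m) $$ (k, l)) \<le> c * s ^ m"
proof -
  define a where "a = complex_of_real (inverse s)"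
  have a0: "a \<noteq> 0" and na: "cmod a = inverse s" using s by (auto simp: a_def norm_inverse)
  have D: "a \<cdot>\<^sub>m A \<in> carrier_mat n n" using A by simp
  have "spectral_radius (a \<cdot>\<^sub>m A) < 1"
  proof -
    obtain e where e: "e \<in> spectrum (a \<cdot>\<^sub>m A)" and r: "spectral_radius (a \<cdot>\<^sub>m A) = cmod e"
      using spectral_radius_mem_max(1)[OF D n] by auto
    then obtain v where "eigenvector (a \<cdot>\<^sub>m A) v e"
      by (auto simp: spectrum_def eigenvalue_def)
    then have v: "v \<in> carrier_vec n" "v \<noteq> 0\<^sub>v n" "(a \<cdot>\<^sub>m A) *\<^sub>v v = e \<cdot>\<^sub>v v"
      using A by (auto simp: eigenvector_def)
    have "A *\<^sub>v v = (e / a) \<cdot>\<^sub>v v"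
    proof (rule eq_vecI)
      fix i assume "i < dim_vec ((e / a) \<cdot>\<^sub>v v)"
      then have i: "i < n" using v by simp
      have "((a \<cdot>\<^sub>m A) *\<^sub>v v) $ i = a * (A *\<^sub>v v) $ i"
        using A v(1) i by (simp add: scalar_prod_def sum_distrib_left mult.assoc)
      then show "(A *\<^sub>v v) $ i = ((e / a) \<cdot>\<^sub>v v) $ i"
        using i v a0 by (simp add: field_simps)
    qed (use A v in simp)
    then have "e / a \<in> spectrum A"
      using A v unfolding spectrum_def eigenvalue_def eigenvector_def by auto
    then have "cmod (e / a) \<le> spectral_radius A"
      using spectral_radius_mem_max(2)[OF A n] by blast
    then have "cmod (e / a) < s" using s by simp
    then show ?thesis using s by (simp add: r norm_divide na field_simps)
  qed
  from spectral_radius_jnf_norm_bound_less_1_upper_triangular[OF D this]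
  obtain c where c: "\<And>m. norm_bound ((a \<cdot>\<^sub>m A) ^\<^sub>m m) c" by blast
  show thesis
  proof
    fix m k l assume kl: "k < n" "l < n"
    have "cmod (((a \<cdot>\<^sub>m A) ^\<^sub>m m) $$ (k, l)) \<le> c"
      using c[of m] kl A by (auto simp: norm_bound_def)
    then have "inverse s ^ m * cmod ((A ^\<^sub>m m) $$ (k, l)) \<le> c"
      using kl A by (simp add: pow_smult_mat[OF A] norm_mult norm_power na)
    then show "cmod ((A ^\<^sub>m m) $$ (k, l)) \<le> c * s ^ m"
      using s by (simp add: field_simps)
  qed
qed

text \<open>If \<open>u\<close> is the vector of moduli of an eigenvector of \<open>M\<close> for an eigenvalue of maximal
  modulus \<open>r\<close>, strictness gives \<open>q\<^sup>N u \<le> R\<^sup>N u\<close> for some \<open>q > r\<close>, so the powers of \<open>R\<close> outgrow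
  those of every \<open>s\<close> with \<open>r < s < q\<close>.\<close>

lemma spectral_radius_less_if_pow_less:
  fixes M :: "complex mat" and R :: "real mat"
  assumes M: "M \<in> carrier_mat n n" and R: "R \<in> carrier_mat n n" and n: "n > 0"
    and less: "\<And>k l. k < n \<Longrightarrow> l < n \<Longrightarrow> cmod ((M ^\<^sub>m N) $$ (k, l)) < (R ^\<^sub>m N) $$ (k, l)"
  shows "spectral_radius M < spectral_radius (map_mat complex_of_real R)"
proof (rule ccontr)
  assume not_less: "\<not> ?thesis"
  \<comment> \<open>For \<open>N = 0\<close> both powers are the identity, and \<open>less\<close>
    would say 1 < 1 on the diagonal.\<close>
  have N: "N > 0" using less[of 0 0] n M R by (cases N) auto
  obtain e where e: "e \<in> spectrum M" and r: "spectral_radius M = cmod e"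
    using spectral_radius_mem_max(1)[OF M n] by auto
  then obtain v where ev: "eigenvector M v e"
    by (auto simp: spectrum_def eigenvalue_def)
  then have v: "v \<in> carrier_vec n" "v \<noteq> 0\<^sub>v n"
    using M by (auto simp: eigenvector_def)
  define u where "u k = cmod (v $ k)" for k
  obtain k0 where k0: "k0 < n" "u k0 > 0"
  proof -
    have "\<exists>k<n. v $ k \<noteq> 0"
      using v by (auto simp: vec_eq_iff)
    then show thesis using that by (auto simp: u_def)
  qed
  have strict: "cmod e ^ N * u k < (\<Sum>l<n. (R ^\<^sub>m N) $$ (k, l) * u l)" if k: "k < n" for k
  proof -
    have "e ^ N * v $ k = (M ^\<^sub>m N *\<^sub>v v) $ k"
      using eigenvector_pow[OF M ev, of N] v k by simp
    also have "\<dots> = (\<Sum>l<n. (M ^\<^sub>m N) $$ (k, l) * v $ l)"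
      using v M k by (simp add: scalar_prod_def lessThan_atLeast0)
    finally have "cmod e ^ N * u k = cmod (\<Sum>l<n. (M ^\<^sub>m N) $$ (k, l) * v $ l)"
      by (metis norm_mult norm_power u_def)
    also have "\<dots> \<le> (\<Sum>l<n. cmod ((M ^\<^sub>m N) $$ (k, l)) * u l)"
      unfolding u_def by (rule order.trans[OF norm_sum]) (simp add: norm_mult)
    also have "\<dots> < (\<Sum>l<n. (R ^\<^sub>m N) $$ (k, l) * u l)"
    proof (rule sum_strict_mono_ex1)
      show "\<forall>l\<in>{..<n}. cmod ((M ^\<^sub>m N) $$ (k, l)) * u l \<le> (R ^\<^sub>m N) $$ (k, l) * u l"
        using less[OF k] by (auto simp: u_def intro!: mult_right_mono[OF less_imp_le])
      show "\<exists>l\<in>{..<n}. cmod ((M ^\<^sub>m N) $$ (k, l)) * u l < (R ^\<^sub>m N) $$ (k, l) * u l"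
        using less[OF k k0(1)] k0 by (intro bexI[of _ k0]) auto
    qed simp
    finally show ?thesis .
  qed
  \<comment> \<open>By continuity each inequality in \<open>strict\<close> survives a small increase
    of \<open>cmod e\<close>; as there are finitely many \<open>k\<close>, one \<open>q\<close>
    serves all of them.\<close>
  have "\<forall>\<^sub>F q in at_right (cmod e). \<forall>k\<in>{..<n}. q ^ N * u k < (\<Sum>l<n. (R ^\<^sub>m N) $$ (k, l) * u l)"
  proof (intro eventually_ball_finite finite_lessThan ballI)
    fix k assume "k \<in> {..<n}"
    then have k: "k < n" by simp
    have "((\<lambda>q. q ^ N * u k) \<longlongrightarrow> cmod e ^ N * u k) (at_right (cmod e))"
      by (intro tendsto_intros)
    then show "\<forall>\<^sub>F q in at_right (cmod e). q ^ N * u k < (\<Sum>l<n. (R ^\<^sub>m N) $$ (k, l) * u l)"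
      using strict[OF k] by (rule order_tendstoD)
  qed
  then have "\<forall>\<^sub>F q in at_right (cmod e). cmod e < q \<and>
      (\<forall>k\<in>{..<n}. q ^ N * u k < (\<Sum>l<n. (R ^\<^sub>m N) $$ (k, l) * u l))"
    by (intro eventually_conj eventually_at_right_less)
  then obtain q where q: "cmod e < q"
    and step: "\<And>k. k < n \<Longrightarrow> q ^ N * u k < (\<Sum>l<n. (R ^\<^sub>m N) $$ (k, l) * u l)"
    using eventually_happens'[OF trivial_limit_at_right_real] by fast
  have q0: "q > 0" using q norm_ge_zero[of e] by linarith
  obtain s where s: "cmod e < s" "s < q" using dense[OF q] by blast
  have s0: "s > 0" using s norm_ge_zero[of e] by linarith
  \<comment> \<open>Entries of this power exceed a modulus, hence are nonnegative; this lets
    \<open>step\<close> be iterated in \<open>grow\<close>.\<close>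
  have RN: "0 \<le> (R ^\<^sub>m N) $$ (k, l)" if "k < n" "l < n" for k l
    using less[OF that] norm_ge_zero[of "(M ^\<^sub>m N) $$ (k, l)"] by linarith
  have grow: "(q ^ N) ^ m * u k \<le> (\<Sum>l<n. (R ^\<^sub>m (N * m)) $$ (k, l) * u l)" if "k < n" for k m
    using that
  proof (induction m arbitrary: k)
    case 0
    have "(\<Sum>l<n. (R ^\<^sub>m (N * 0)) $$ (k, l) * u l) = (\<Sum>l<n. if l = k then u l else 0)"
      using 0 R by (intro sum.cong) auto
    then show ?case using 0 by simp
  next
    case (Suc m)
    have "(q ^ N) ^ Suc m * u k = (q ^ N) ^ m * (q ^ N * u k)"
      by simp
    also have "\<dots> \<le> (q ^ N) ^ m * (\<Sum>l<n. (R ^\<^sub>m N) $$ (k, l) * u l)"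
      using step[OF Suc.prems] q0 by (intro mult_left_mono) auto
    also have "\<dots> = (\<Sum>j<n. (R ^\<^sub>m N) $$ (k, j) * ((q ^ N) ^ m * u j))"
      by (simp add: sum_distrib_left mult_ac)
    also have "\<dots> \<le> (\<Sum>j<n. (R ^\<^sub>m N) $$ (k, j) * (\<Sum>l<n. (R ^\<^sub>m (N * m)) $$ (j, l) * u l))"
      using Suc RN by (intro sum_mono mult_left_mono) auto
    also have "\<dots> = (\<Sum>j<n. \<Sum>l<n. (R ^\<^sub>m N) $$ (k, j) * (R ^\<^sub>m (N * m)) $$ (j, l) * u l)"
      by (simp add: sum_distrib_left mult.assoc)
    also have "\<dots> = (\<Sum>l<n. \<Sum>j<n. (R ^\<^sub>m N) $$ (k, j) * (R ^\<^sub>m (N * m)) $$ (j, l) * u l)"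
      by (rule sum.swap)
    also have "\<dots> = (\<Sum>l<n. (R ^\<^sub>m (N * Suc m)) $$ (k, l) * u l)"
      using index_pow_mat_add[OF R Suc.prems, of _ N "N * m"] by (simp add: sum_distrib_right)
    finally show ?case .
  qed
  have C: "map_mat complex_of_real R \<in> carrier_mat n n" using R by simp
  \<comment> \<open>The negated claim bounds the spectral radius of \<open>R\<close> by
    \<open>cmod e\<close>, which is below \<open>s\<close>.\<close>
  have "spectral_radius (map_mat complex_of_real R) < s"
    using not_less s r by simp
  from spectral_radius_less_imp_pow_bound[OF C n this s0]
  obtain c where c: "\<And>m k l. k < n \<Longrightarrow> l < n \<Longrightarrow>
      cmod ((map_mat complex_of_real R ^\<^sub>m m) $$ (k, l)) \<le> c * s ^ m" by blast
  have R_bound: "(R ^\<^sub>m m) $$ (k, l) \<le> c * s ^ m" if "k < n" "l < n" for m k l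
  proof -
    have "map_mat complex_of_real R ^\<^sub>m m = map_mat complex_of_real (R ^\<^sub>m m)"
      by (rule of_real_hom.mat_hom_pow[OF R, symmetric])
    then show ?thesis using c[OF that, of m] that R by simp
  qed
  \<comment> \<open>Comparing \<open>grow\<close> with \<open>R_bound\<close> at \<open>k0\<close>,
    where \<open>u\<close> is positive, traps a geometric sequence of ratio above 1 under a
    constant.\<close>
  have bound: "((q / s) ^ N) ^ m \<le> c * (\<Sum>l<n. u l) / u k0" for m
  proof -
    have "(q ^ N) ^ m * u k0 \<le> (\<Sum>l<n. (R ^\<^sub>m (N * m)) $$ (k0, l) * u l)"
      using grow k0 by blast
    also have "\<dots> \<le> (\<Sum>l<n. c * s ^ (N * m) * u l)"
      using R_bound k0 by (intro sum_mono mult_right_mono) (auto simp: u_def)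
    also have "\<dots> = (s ^ N) ^ m * (c * (\<Sum>l<n. u l))"
      by (simp add: sum_distrib_left power_mult mult_ac)
    finally show ?thesis
      using k0 s0 by (simp add: power_divide field_simps)
  qed
  have "1 < (q / s) ^ N"
    using s s0 N by (intro one_less_power) auto
  from real_arch_pow[OF this, of "c * (\<Sum>l<n. u l) / u k0"] bound show False
    using not_less by (meson leD)
qed

subsection \<open>Eventual positivity of the transition probabilities\<close>

text \<open>The least positive difference \<open>d\<close> of two members of \<open>T\<close>
  divides every member, so it is 1. Two consecutive members \<open>b\<close> and
  \<open>b + 1\<close> then generate every large number.\<close>

lemma nat_semigroup_eventually_mem:
  fixes T :: "nat set"
  assumes add: "\<And>a b. a \<in> T \<Longrightarrow> b \<in> T \<Longrightarrow> a + b \<in> T" and gcd: "Gcd T = 1"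
  shows "\<forall>\<^sub>F n in sequentially. n \<in> T"
proof -
  have mult: "n * a \<in> T" if "a \<in> T" "n > 0" for a n
    using that(2)
  proof (induction n rule: nat_induct_non_zero)
    case (Suc n)
    then show ?case using add[OF that(1) Suc.IH] by simp
  qed (use that in simp)
  obtain t0 where t0: "t0 \<in> T" "t0 > 0"
    using gcd Gcd_0_iff[of T] by (metis bot_nat_0.not_eq_extremum subsetI singletonI zero_neq_one)
  define D where "D d \<longleftrightarrow> d > 0 \<and> (\<exists>b\<in>T. b + d \<in> T)" for d
  have "D t0" using t0 add unfolding D_def by blast
  define d where "d = (LEAST d. D d)"
  have Dd: "D d" and least: "\<And>d'. D d' \<Longrightarrow> d \<le> d'"
    unfolding d_def using \<open>D t0\<close> by (auto intro: LeastI Least_le)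
  obtain b where b: "b \<in> T" "b + d \<in> T" "d > 0" using Dd by (auto simp: D_def)
  have "d dvd t" if t: "t \<in> T" for t
  proof (rule ccontr)
    assume "\<not> d dvd t"
    then have r: "0 < t mod d" by (simp add: dvd_eq_mod_eq_0 neq0_conv)
    \<comment> \<open>The members \<open>Suc p * b + t\<close> and \<open>p * (b + d) + b\<close>
      differ by exactly \<open>t mod d\<close>, a positive difference smaller than
      \<open>d\<close>.\<close>
    define p where "p = t div d"
    have tp: "t = p * d + t mod d" by (simp add: p_def)
    have "Suc p * b + t \<in> T" using add[OF mult[OF b(1)] t] by blast
    moreover have "p * (b + d) + b \<in> T"
      using add mult b by (cases "p = 0") auto
    moreover have "Suc p * b + t = (p * (b + d) + b) + t mod d"
      by (subst tp) (simp add: algebra_simps)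
    ultimately have "D (t mod d)" using r unfolding D_def by metis
    then show False using least[of "t mod d"] mod_less_divisor[OF b(3), of t] by simp
  qed
  then have "d dvd Gcd T" by (rule Gcd_greatest)
  then have "d = 1" using gcd by simp
  then have b1: "b + 1 \<in> T" using b by simp
  show ?thesis
  proof (rule eventually_sequentiallyI)
    \<comment> \<open>From \<open>b * b\<close> on, the quotient by \<open>b\<close> is at least
      \<open>b\<close> and so exceeds the remainder; the extra 1 keeps \<open>n\<close> positive
      when \<open>b = 0\<close>.\<close>
    fix n assume n: "b * b + 1 \<le> n"
    show "n \<in> T"
    proof (cases "b = 0")
      case True
      then show ?thesis using mult[OF b1, of n] n by simp
    next
      case False
      define q r where "q = n div b" and "r = n mod b"
      have nq: "n = q * b + r" by (simp add: q_def r_def)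
      have rb: "r < b" using False by (simp add: r_def)
      have "b \<le> q" unfolding q_def using n False
        by (metis add_leD1 div_le_mono nonzero_mult_div_cancel_left)
      then have rq: "r < q" using rb by simp
      have "n = (q - r) * b + r * (b + 1)"
        using rq by (subst nq) (simp add: diff_mult_distrib algebra_simps)
      moreover have "(q - r) * b \<in> T" using mult b rq by simp
      ultimately show ?thesis
        using add mult[OF b1, of r] by (cases "r = 0") auto
    qed
  qed
qed

text \<open>Finite range turns the infinite sums in \<open>nstep\<close> into finite ones, so no
  summability question arises and positivity can be read off single terms.\<close>

locale finite_range_kernel =
  fixes S :: "'s set" and P :: "'s \<Rightarrow> 's \<Rightarrow> real"
  assumes finite_range: "x \<in> S \<Longrightarrow> finite {u \<in> S. P x u \<noteq> 0}"
    and kernel_nonneg: "x \<in> S \<Longrightarrow> u \<in> S \<Longrightarrow> 0 \<le> P x u"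
begin

lemma nstep_Suc_eq:
  assumes "x \<in> S" "finite F" "F \<subseteq> S" "\<And>u. u \<in> S - F \<Longrightarrow> P x u = 0"
  shows "nstep S P (Suc n) x y = (\<Sum>u\<in>F. P x u * nstep S P n u y)"
proof -
  have "nstep S P (Suc n) x y = (\<Sum>\<^sub>\<infinity>u\<in>F. P x u * nstep S P n u y)"
    unfolding nstep.simps using assms by (intro infsum_cong_neutral) auto
  then show ?thesis using assms by simp
qed

lemma nstep_nonneg: "x \<in> S \<Longrightarrow> 0 \<le> nstep S P n x y"
proof (induction n arbitrary: x)
  case (Suc n)
  then show ?case
    unfolding nstep.simps by (intro infsum_nonneg mult_nonneg_nonneg kernel_nonneg)
qed simp

text \<open>A finite sum of nonnegative terms is positive exactly when one term is. Positivity of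
  \<open>nstep\<close> thus becomes existence of a path.\<close>

lemma nstep_Suc_pos_iff:
  assumes x: "x \<in> S"
  shows "0 < nstep S P (Suc n) x y \<longleftrightarrow> (\<exists>u\<in>S. 0 < P x u \<and> 0 < nstep S P n u y)"
proof -
  let ?F = "{u \<in> S. P x u \<noteq> 0}"
  have nn: "0 \<le> P x u * nstep S P n u y" if "u \<in> S" for u
    using that x by (simp add: kernel_nonneg nstep_nonneg)
  have "nstep S P (Suc n) x y = (\<Sum>u\<in>?F. P x u * nstep S P n u y)"
    using finite_range[OF x] x by (intro nstep_Suc_eq) auto
  also have "0 < \<dots> \<longleftrightarrow> (\<exists>u\<in>?F. 0 < P x u * nstep S P n u y)"
  proof
    assume "0 < (\<Sum>u\<in>?F. P x u * nstep S P n u y)"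
    then show "\<exists>u\<in>?F. 0 < P x u * nstep S P n u y"
      by (metis (no_types, lifting) not_less sum_nonpos)
  next
    assume "\<exists>u\<in>?F. 0 < P x u * nstep S P n u y"
    then obtain v where "v \<in> ?F" "0 < P x v * nstep S P n v y" by blast
    then show "0 < (\<Sum>u\<in>?F. P x u * nstep S P n u y)"
      using nn by (intro sum_pos2[OF finite_range[OF x]]) simp_all
  qed
  also have "\<dots> \<longleftrightarrow> (\<exists>u\<in>S. 0 < P x u \<and> 0 < nstep S P n u y)"
  proof -
    have "0 < P x u * nstep S P n u y \<longleftrightarrow> 0 < P x u \<and> 0 < nstep S P n u y" if "u \<in> S" for u
      using kernel_nonneg[OF x that] nstep_nonneg[OF that, of n y]
      by (simp add: zero_less_mult_iff)
    then show ?thesis by force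
  qed
  finally show ?thesis .
qed

lemma nstep_add_pos:
  "\<lbrakk>x \<in> S; 0 < nstep S P m x u; 0 < nstep S P n u y\<rbrakk> \<Longrightarrow> 0 < nstep S P (m + n) x y"
proof (induction m arbitrary: x)
  case 0
  then show ?case by (auto split: if_splits)
next
  case (Suc m)
  from Suc.prems(1,2) obtain v where "v \<in> S" "0 < P x v" "0 < nstep S P m v u"
    unfolding nstep_Suc_pos_iff[OF Suc.prems(1)] by blast
  then show ?case
    using Suc.IH Suc.prems(3) unfolding add_Suc nstep_Suc_pos_iff[OF Suc.prems(1)] by blast
qed

text \<open>Positive return times to \<open>y\<close> are closed under addition and have gcd 1, so
  they contain all large numbers; a fixed path from \<open>x\<close> to \<open>y\<close> is put in
  front.\<close>

lemma nstep_eventually_pos: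
  assumes "irreducible_chain S P" "aperiodic_chain S P" "x \<in> S" "y \<in> S"
  shows "\<forall>\<^sub>F n in sequentially. 0 < nstep S P n x y"
proof -
  obtain n0 where n0: "0 < nstep S P n0 x y"
    using assms by (auto simp: irreducible_chain_def)
  let ?T = "{n. 1 \<le> n \<and> 0 < nstep S P n y y}"
  have "\<forall>\<^sub>F n in sequentially. n \<in> ?T"
  proof (rule nat_semigroup_eventually_mem)
    show "Gcd ?T = 1" using assms by (simp add: aperiodic_chain_def)
    show "a + b \<in> ?T" if "a \<in> ?T" "b \<in> ?T" for a b
      using that nstep_add_pos[OF assms(4)] by auto
  qed
  then obtain n1 where n1: "\<And>n. n \<ge> n1 \<Longrightarrow> n \<in> ?T"
    unfolding eventually_sequentially by blast
  show ?thesis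
  proof (rule eventually_sequentiallyI)
    fix n assume "n0 + n1 \<le> n"
    then show "0 < nstep S P n x y"
      using nstep_add_pos[OF assms(3) n0, of "n - n0" y] n1[of "n - n0"] by simp
  qed
qed

end

subsection \<open>Powers of the matrix generating function\<close>

lemma finite_H [simp]: "finite H"
  by (simp add: H_def)

lemma transition_blocks_nonneg:
  assumes "transition_blocks s0 I J B" "i \<in> I" "j \<in> J" "k < s0" "l < s0"
  shows "0 \<le> B i j $$ (k, l)"
  using assms by (force simp: transition_blocks_def nonneg_matrix_def elements_mat_def)

text \<open>A common index set for the successors of a state and for the terms of a matrix product,
  so that \<open>nstep\<close> and the powers of \<open>C_mat\<close> and \<open>R_mat\<close>
  unfold over the same sum.\<close>

definition steps :: "nat \<Rightarrow> (nat \<times> int \<times> int) set" where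
  "steps s0 = {..<s0} \<times> H \<times> H"

lemma finite_steps [simp]: "finite (steps s0)"
  by (simp add: steps_def)

lemma P_free_outside_range:
  assumes "u \<in> S_free s0 - (\<lambda>(m, i, j). (x1 + i, x2 + j, m)) ` steps s0"
  shows "P_free A (x1, x2, k) u = 0"
proof -
  obtain u1 u2 m where u: "u = (u1, u2, m)" by (metis prod_cases3)
  show ?thesis
  proof (rule ccontr)
    assume "P_free A (x1, x2, k) u \<noteq> 0"
    then have "(m, u1 - x1, u2 - x2) \<in> steps s0"
      using assms by (auto simp: u P_free_def steps_def S_free_def split: if_splits)
    moreover have "u = (\<lambda>(m, i, j). (x1 + i, x2 + j, m)) (m, u1 - x1, u2 - x2)"
      by (simp add: u)
    ultimately show False using assms by blast
  qed
qed

lemma finite_range_kernel_free: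
  assumes "transition_blocks s0 H H A"
  shows "finite_range_kernel (S_free s0) (P_free A)"
proof
  fix x assume "x \<in> S_free s0"
  obtain x1 x2 k where x: "x = (x1, x2, k)" by (metis prod_cases3)
  have "{u \<in> S_free s0. P_free A x u \<noteq> 0} \<subseteq> (\<lambda>(m, i, j). (x1 + i, x2 + j, m)) ` steps s0"
    using P_free_outside_range unfolding x by blast
  then show "finite {u \<in> S_free s0. P_free A x u \<noteq> 0}"
    by (rule finite_subset) simp
next
  fix x u assume "x \<in> S_free s0" "u \<in> S_free s0"
  then show "0 \<le> P_free A x u"
    using transition_blocks_nonneg[OF assms] by (auto simp: P_free_def S_free_def)
qed

lemma nstep_free_Suc:
  assumes A: "transition_blocks s0 H H A" and k: "k < s0"
  shows "nstep (S_free s0) (P_free A) (Suc n) (x1, x2, k) y =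
    (\<Sum>(m, i, j)\<in>steps s0. A i j $$ (k, m) * nstep (S_free s0) (P_free A) n (x1 + i, x2 + j, m) y)"
proof -
  interpret finite_range_kernel "S_free s0" "P_free A"
    using A by (rule finite_range_kernel_free)
  let ?f = "\<lambda>(m, i, j). (x1 + i, x2 + j, m :: nat)"
  have "nstep (S_free s0) (P_free A) (Suc n) (x1, x2, k) y =
      (\<Sum>u\<in>?f ` steps s0. P_free A (x1, x2, k) u * nstep (S_free s0) (P_free A) n u y)"
    using k by (intro nstep_Suc_eq P_free_outside_range) (auto simp: S_free_def steps_def)
  also have "\<dots> = (\<Sum>(m, i, j)\<in>steps s0. A i j $$ (k, m) *
      nstep (S_free s0) (P_free A) n (x1 + i, x2 + j, m) y)"
    by (subst sum.reindex) (auto simp: inj_on_def steps_def P_free_def intro!: sum.cong)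
  finally show ?thesis .
qed

text \<open>The matrix C(|z|,|w|) with real entries, so that they can be compared by order;
  \<open>C_mat_cmod\<close> makes the link.\<close>

definition R_mat :: "nat \<Rightarrow> (int \<Rightarrow> int \<Rightarrow> real mat) \<Rightarrow> complex \<Rightarrow> complex \<Rightarrow> real mat" where
  "R_mat s0 A z w = mat s0 s0 (\<lambda>(k, l).
     \<Sum>i\<in>H. \<Sum>j\<in>H. A i j $$ (k, l) * cmod (z powi i * w powi j))"

lemma C_mat_carrier: "C_mat s0 A z w \<in> carrier_mat s0 s0"
  by (simp add: C_mat_def)

lemma R_mat_carrier: "R_mat s0 A z w \<in> carrier_mat s0 s0"
  by (simp add: R_mat_def)

lemma C_mat_cmod:
  "C_mat s0 A (complex_of_real (cmod z)) (complex_of_real (cmod w)) =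
     map_mat complex_of_real (R_mat s0 A z w)"
  by (intro eq_matI) (simp_all add: C_mat_def R_mat_def norm_mult norm_power_int mult.assoc)

text \<open>The factor is split off on the left, matching the first-step recursion of
  \<open>nstep\<close>.\<close>

lemma C_mat_pow_Suc:
  assumes "k < s0" "l < s0"
  shows "(C_mat s0 A z w ^\<^sub>m Suc n) $$ (k, l) =
    (\<Sum>(m, i, j)\<in>steps s0. complex_of_real (A i j $$ (k, m)) * (z powi i * w powi j) *
       (C_mat s0 A z w ^\<^sub>m n) $$ (m, l))"
  using index_pow_mat_add[OF C_mat_carrier assms, of A z w 1 n] assms
  by (simp add: C_mat_def steps_def sum.cartesian_product[symmetric] sum_distrib_right
      mult.assoc)

lemma R_mat_pow_Suc:
  assumes "k < s0" "l < s0"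
  shows "(R_mat s0 A z w ^\<^sub>m Suc n) $$ (k, l) =
    (\<Sum>(m, i, j)\<in>steps s0. A i j $$ (k, m) * cmod (z powi i * w powi j) *
       (R_mat s0 A z w ^\<^sub>m n) $$ (m, l))"
  using index_pow_mat_add[OF R_mat_carrier assms, of A z w 1 n] assms
  by (simp add: R_mat_def steps_def sum.cartesian_product[symmetric] sum_distrib_right
      mult.assoc)

text \<open>The entry \<open>(k, l)\<close> of \<open>C(z,w)\<^sup>n\<close> is a sum over \<open>n\<close>-step paths of the free chain. The paths
  with total displacement \<open>(a, b)\<close> carry the common phase of \<open>z\<^sup>a w\<^sup>b\<close>, and the estimate records
  the loss that the triangle inequality incurs on them.\<close>

lemma Re_C_mat_pow_le:
  assumes A: "transition_blocks s0 H H A" and zw: "z \<noteq> 0" "w \<noteq> 0" and "k < s0" "l < s0"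
  shows "Re (c * (C_mat s0 A z w ^\<^sub>m n) $$ (k, l)) \<le>
    cmod c * (R_mat s0 A z w ^\<^sub>m n) $$ (k, l) -
    nstep (S_free s0) (P_free A) n (x1, x2, k) (y1, y2, l) *
      (cmod (c * (z powi (y1 - x1) * w powi (y2 - x2))) -
       Re (c * (z powi (y1 - x1) * w powi (y2 - x2))))"
  using assms(4)
\<comment> \<open>The constant \<open>c\<close> must vary because it absorbs the factor of the first
  step; the starting level and phase move along.\<close>
proof (induction n arbitrary: c k x1 x2)
  case 0
  have "Re c \<le> cmod c" by (rule complex_Re_le_cmod)
  then show ?case
    using 0 assms by (auto simp: C_mat_def R_mat_def)
next
  case (Suc n)
  let ?p = "\<lambda>i j. z powi i * w powi j"
  let ?q = "?p (y1 - x1) (y2 - x2)"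
  let ?N = "nstep (S_free s0) (P_free A)"
  \<comment> \<open>The increments of the first step and the remaining displacement add up to the
    total one, so the loss term is the same for every first step.\<close>
  have shift: "?p i j * ?p (y1 - (x1 + i)) (y2 - (x2 + j)) = ?q" for i j
  proof -
    have "z powi (y1 - x1) = z powi i * z powi (y1 - (x1 + i))"
      using power_int_add[of z i "y1 - (x1 + i)"] zw by simp
    moreover have "w powi (y2 - x2) = w powi j * w powi (y2 - (x2 + j))"
      using power_int_add[of w j "y2 - (x2 + j)"] zw by simp
    ultimately show ?thesis by (simp only: mult_ac)
  qed
  have "Re (c * (C_mat s0 A z w ^\<^sub>m Suc n) $$ (k, l)) =
      (\<Sum>(m, i, j)\<in>steps s0. A i j $$ (k, m) * Re (c * ?p i j * (C_mat s0 A z w ^\<^sub>m n) $$ (m, l)))"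
    unfolding C_mat_pow_Suc[OF Suc.prems assms(5)] sum_distrib_left Re_sum
  proof (rule sum.cong[OF refl], clarify)
    fix m i j
    have Re_of_real_mult: "Re (complex_of_real a * b) = a * Re b" for a b by simp
    have "c * (complex_of_real (A i j $$ (k, m)) * ?p i j * (C_mat s0 A z w ^\<^sub>m n) $$ (m, l)) =
      complex_of_real (A i j $$ (k, m)) * (c * ?p i j * (C_mat s0 A z w ^\<^sub>m n) $$ (m, l))"
      by (simp add: mult_ac)
    then show "Re (c * (complex_of_real (A i j $$ (k, m)) * ?p i j * (C_mat s0 A z w ^\<^sub>m n) $$ (m, l)))
      = A i j $$ (k, m) * Re (c * ?p i j * (C_mat s0 A z w ^\<^sub>m n) $$ (m, l))"
      by (simp only: Re_of_real_mult)
  qed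
  also have "\<dots> \<le> (\<Sum>(m, i, j)\<in>steps s0. A i j $$ (k, m) *
      (cmod (c * ?p i j) * (R_mat s0 A z w ^\<^sub>m n) $$ (m, l) -
       ?N n (x1 + i, x2 + j, m) (y1, y2, l) * (cmod (c * ?q) - Re (c * ?q))))"
  proof (rule sum_mono, clarify)
    fix m i j assume "(m, i, j) \<in> steps s0"
    then have m: "m < s0" and ij: "i \<in> H" "j \<in> H" by (auto simp: steps_def)
    have "Re (c * ?p i j * (C_mat s0 A z w ^\<^sub>m n) $$ (m, l)) \<le>
      cmod (c * ?p i j) * (R_mat s0 A z w ^\<^sub>m n) $$ (m, l) -
       ?N n (x1 + i, x2 + j, m) (y1, y2, l) * (cmod (c * ?q) - Re (c * ?q))"
      using Suc.IH[OF m, of "c * ?p i j" "x1 + i" "x2 + j"] by (simp only: mult.assoc[of c] shift)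
    then show "A i j $$ (k, m) * Re (c * ?p i j * (C_mat s0 A z w ^\<^sub>m n) $$ (m, l)) \<le>
      A i j $$ (k, m) * (cmod (c * ?p i j) * (R_mat s0 A z w ^\<^sub>m n) $$ (m, l) -
       ?N n (x1 + i, x2 + j, m) (y1, y2, l) * (cmod (c * ?q) - Re (c * ?q)))"
      using transition_blocks_nonneg[OF A ij Suc.prems m] by (rule mult_left_mono)
  qed
  also have "\<dots> = cmod c * (R_mat s0 A z w ^\<^sub>m Suc n) $$ (k, l) -
      ?N (Suc n) (x1, x2, k) (y1, y2, l) * (cmod (c * ?q) - Re (c * ?q))"
    unfolding R_mat_pow_Suc[OF Suc.prems assms(5)] nstep_free_Suc[OF A Suc.prems]
      sum_distrib_left sum_distrib_right sum_subtractf[symmetric]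
    by (intro sum.cong) (auto simp: norm_mult algebra_simps)
  finally show ?case .
qed

section \<open>Strictness from the equality case, and the conclusion\<close>

lemma cmod_le_Re_iff: "cmod x \<le> Re x \<longleftrightarrow> x = complex_of_real (cmod x)"
proof
  assume "cmod x \<le> Re x"
  then have "Re x = cmod x" using complex_Re_le_cmod[of x] by simp
  moreover from this have "Im x = 0" using cmod_power2[of x] by simp
  ultimately show "x = complex_of_real (cmod x)" by (simp add: complex_eq_iff)
next
  assume x: "x = complex_of_real (cmod x)"
  have "Re x = cmod x" by (subst x) simp
  then show "cmod x \<le> Re x" by simp
qed

lemma cmod_C_mat_pow_less:
  assumes A: "transition_blocks s0 H H A" and zw: "z \<noteq> 0" "w \<noteq> 0" and kl: "k < s0" "l < s0"
    and phase: "complex_of_real (cmod z) \<noteq> z \<or> complex_of_real (cmod w) \<noteq> w"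
    and pos: "\<And>y. y \<in> {(0, 0, l), (1, 0, l), (0, 1, l)} \<Longrightarrow>
      0 < nstep (S_free s0) (P_free A) n (0, 0, k) y"
  shows "cmod ((C_mat s0 A z w ^\<^sub>m n) $$ (k, l)) < (R_mat s0 A z w ^\<^sub>m n) $$ (k, l)"
proof (rule ccontr)
  define x where "x = (C_mat s0 A z w ^\<^sub>m n) $$ (k, l)"
  assume "\<not> ?thesis"
  then have le: "(R_mat s0 A z w ^\<^sub>m n) $$ (k, l) \<le> cmod x" by (simp add: x_def)
  \<comment> \<open>Multiplication by \<open>c\<close> rotates \<open>x\<close> onto the nonnegative
    real axis; the value 1 at \<open>x = 0\<close> keeps \<open>cmod c = 1\<close>.\<close>
  define c where "c = (if x = 0 then 1 else cnj x / complex_of_real (cmod x))"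
  have c: "cmod c = 1" by (simp add: c_def norm_divide)
  have "c * x = complex_of_real (cmod x)"
    by (simp add: c_def mult.commute complex_norm_square[symmetric] power2_eq_square)
  then have cx: "Re (c * x) = cmod x" by simp
  \<comment> \<open>Without strictness the loss in \<open>Re_C_mat_pow_le\<close> must vanish for
    each of the three reachable displacements.\<close>
  have key: "cmod (c * (z powi a * w powi b)) \<le> Re (c * (z powi a * w powi b))"
    if "(a, b, l) \<in> {(0, 0, l), (1, 0, l), (0, 1, l)}" for a b
  proof -
    have "nstep (S_free s0) (P_free A) n (0, 0, k) (a, b, l) *
      (cmod (c * (z powi a * w powi b)) - Re (c * (z powi a * w powi b))) \<le> 0"
      using Re_C_mat_pow_le[OF A zw kl, of c n 0 0 a b] cx c le by (simp add: x_def)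
    with pos[OF that] show ?thesis by (simp add: mult_le_0_iff)
  qed
  \<comment> \<open>Displacement (0, 0) makes \<open>c\<close> itself a nonnegative real of modulus
    1. With \<open>c = 1\<close>, the other two displacements make \<open>z\<close> and
    \<open>w\<close> equal to their moduli.\<close>
  have "c = 1" using iffD1[OF cmod_le_Re_iff key[of 0 0]] c by simp
  then show False
    using iffD1[OF cmod_le_Re_iff key[of 1 0]] iffD1[OF cmod_le_Re_iff key[of 0 1]] phase
    by simp
qed

theorem proposition4p1:
  fixes s0 :: nat
    and A A1 A2 :: "int \<Rightarrow> int \<Rightarrow> real mat"
    and z w :: complex
  assumes "s0 \<ge> 1"
    and "transition_blocks s0 H H A"
    and "transition_blocks s0 H Hp A1"
    and "transition_blocks s0 Hp H A2"
    and "irreducible_chain (S_free s0) (P_free A)" "aperiodic_chain (S_free s0) (P_free A)"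
    and "irreducible_chain (S_one s0) (P_one A A1)" "aperiodic_chain (S_one s0) (P_one A A1)"
    and "irreducible_chain (S_two s0) (P_two A A2)" "aperiodic_chain (S_two s0) (P_two A A2)"
    and "z \<noteq> 0" "w \<noteq> 0"
    and "complex_of_real (cmod z) \<noteq> z \<or> complex_of_real (cmod w) \<noteq> w"
  shows "spectral_radius (C_mat s0 A z w)
           < spectral_radius (C_mat s0 A (complex_of_real (cmod z)) (complex_of_real (cmod w)))"
proof -
  interpret finite_range_kernel "S_free s0" "P_free A"
    using assms(2) by (rule finite_range_kernel_free)
  \<comment> \<open>Only finitely many phases and displacements occur, so a single exponent works
    for all.\<close>
  have "\<forall>\<^sub>F n in sequentially. \<forall>k\<in>{..<s0}. \<forall>l\<in>{..<s0}. \<forall>y\<in>{(0, 0, l), (1, 0, l), (0, 1, l)}.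
      0 < nstep (S_free s0) (P_free A) n (0, 0, k) y"
    by (intro eventually_ball_finite ballI nstep_eventually_pos assms(5,6))
      (auto simp: S_free_def)
  then obtain N where N: "\<And>k l y. \<lbrakk>k < s0; l < s0; y \<in> {(0, 0, l), (1, 0, l), (0, 1, l)}\<rbrakk> \<Longrightarrow>
      0 < nstep (S_free s0) (P_free A) N (0, 0, k) y"
    unfolding eventually_sequentially by (metis (lifting) lessThan_iff order_refl)
  show ?thesis
    unfolding C_mat_cmod
  proof (rule spectral_radius_less_if_pow_less[OF C_mat_carrier R_mat_carrier])
    show "0 < s0" using assms(1) by simp
    show "cmod ((C_mat s0 A z w ^\<^sub>m N) $$ (k, l)) < (R_mat s0 A z w ^\<^sub>m N) $$ (k, l)"
      if "k < s0" "l < s0" for k l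
      using assms(2,11-13) that N[OF that] by (intro cmod_C_mat_pow_less)
  qed
qed

end
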